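(* Let $\nu$ be a translation invariant $\sigma$-finite measure on $\mathcal{P}(\mathbb{Z})\setminus\{\emptyset\}$ such that $\nu$-a.e. $S\in\mathcal{P}(\mathbb{Z})$ has a smallest element. Then $X^\nu$ is a Bernoulli shift, i.e. it is a factor of an i.i.d. process.
   Context: Identify the power set $\mathcal{P}(\mathbb{Z})$ with $\{0,1\}^{\mathbb{Z}}$ (product topology, Borel $\sigma$-algebra). For a $\sigma$-finite measure $\nu$ on $\mathcal{P}(\mathbb{Z})\setminus\{\emptyset\}$, let $Y^\nu=\{B_j\}_{j\in I}$ be the Poisson process on $\mathcal{P}(\mathbb{Z})\setminus\{\emptyset\}$ with intensity measure $\nu$. Define $X^\nu=(X^\nu_i)_{i\in\mathbb{Z}}$ by $X^\nu_i=1$ if $i\in\bigcup_{j\in I}B_j$ and $X^\nu_i=0$ otherwise. Translation invariance is with respect to the natural action of $\mathbb{Z}$. A process indexed by $\mathbb{Z}$ is a factor of an i.i.d. process if there is an i.i.d. process indexed by $\mathbb{Z}$ and a measurable map commuting with the shift that maps it to a process with the given law; this is what is meant by a Bernoulli shift. *)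

theory Defs
  imports "HOL-Probability.Probability"
begin

text \<open>The power set of the integers, identified with \<open>{0,1}\<^sup>\<int>\<close> through indicator functions;
  \<^typ>\<open>int \<Rightarrow> bool\<close> carries the product topology of the discrete topology on \<^typ>\<open>bool\<close>.\<close>

definition pow_int :: "int set measure" where
  "pow_int = vimage_algebra UNIV (\<lambda>S i. i \<in> S) (borel :: (int \<Rightarrow> bool) measure)"

definition nonempty_pow_int :: "int set measure" where
  "nonempty_pow_int = restrict_space pow_int (- {{}})"

definition translation_invariant :: "int set measure \<Rightarrow> bool" where
  "translation_invariant \<nu> \<longleftrightarrow> (\<forall>k. distr \<nu> \<nu> (\<lambda>S. (\<lambda>i. i + k) ` S) = \<nu>)"

text \<open>A random family \<open>{B\<^sub>j}\<^sub>j\<^sub>\<in>\<^sub>I\<close> is given by a random index set \<open>I \<omega>\<close> and points \<open>B \<omega> j\<close>.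
  Points are counted with multiplicity, so that intensities with atoms are covered.\<close>

definition point_count :: "('w \<Rightarrow> 'j set) \<Rightarrow> ('w \<Rightarrow> 'j \<Rightarrow> 'a) \<Rightarrow> 'a set \<Rightarrow> 'w \<Rightarrow> ennreal" where
  "point_count I B A \<omega> = emeasure (count_space UNIV) {j \<in> I \<omega>. B \<omega> j \<in> A}"

text \<open>The Poisson law is written out because \<^const>\<open>poisson_pmf\<close> requires a positive rate,
  whereas here sets of measure zero occur (with \<open>0 ^ 0 = 1\<close>).\<close>

definition poisson_process ::
  "'w measure \<Rightarrow> 'a measure \<Rightarrow> ('w \<Rightarrow> 'j set) \<Rightarrow> ('w \<Rightarrow> 'j \<Rightarrow> 'a) \<Rightarrow> bool" where
  "poisson_process M \<nu> I B \<longleftrightarrow>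
     prob_space M \<and>
     (\<forall>\<omega>\<in>space M. \<forall>j\<in>I \<omega>. B \<omega> j \<in> space \<nu>) \<and>
     (\<forall>A\<in>sets \<nu>. point_count I B A \<in> borel_measurable M) \<and>
     (\<forall>A\<in>sets \<nu>. emeasure \<nu> A < \<infinity> \<longrightarrow>
        (\<forall>k::nat. measure M {\<omega> \<in> space M. point_count I B A \<omega> = of_nat k} =
           measure \<nu> A ^ k / fact k * exp (- measure \<nu> A))) \<and>
     (\<forall>A\<in>sets \<nu>. emeasure \<nu> A = \<infinity> \<longrightarrow> (AE \<omega> in M. point_count I B A \<omega> = \<infinity>)) \<and>
     (\<forall>(n::nat) A. A ` {..<n} \<subseteq> sets \<nu> \<and> disjoint_family_on A {..<n} \<longrightarrow>
        prob_space.indep_vars M (\<lambda>_. borel) (\<lambda>m. point_count I B (A m)) {..<n})"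

definition covered_process ::
  "('w \<Rightarrow> 'j set) \<Rightarrow> ('w \<Rightarrow> 'j \<Rightarrow> int set) \<Rightarrow> int \<Rightarrow> 'w \<Rightarrow> nat" where
  "covered_process I B i \<omega> = (if i \<in> (\<Union>j\<in>I \<omega>. B \<omega> j) then 1 else 0)"

definition iid_process :: "'w measure \<Rightarrow> 'e measure \<Rightarrow> (int \<Rightarrow> 'w \<Rightarrow> 'e) \<Rightarrow> bool" where
  "iid_process M E \<xi> \<longleftrightarrow>
     prob_space M \<and>
     prob_space.indep_vars M (\<lambda>_. E) \<xi> UNIV \<and>
     (\<forall>i j. distr M E (\<xi> i) = distr M E (\<xi> j))"

text \<open>The i.i.d. process may live on any probability space and take values in any standard Borel
  space. As HOL cannot quantify over types, the values are real and the sample space is a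
  probability space on \<^typ>\<open>int \<Rightarrow> real\<close>; up to Borel isomorphism of the values this
  realises every law of an i.i.d. process.\<close>

definition factor_of_iid :: "'w measure \<Rightarrow> 'e measure \<Rightarrow> (int \<Rightarrow> 'w \<Rightarrow> 'e) \<Rightarrow> bool" where
  "factor_of_iid M E X \<longleftrightarrow>
     (\<forall>i. X i \<in> measurable M E) \<and>
     (\<exists>(N :: (int \<Rightarrow> real) measure) (\<xi> :: int \<Rightarrow> (int \<Rightarrow> real) \<Rightarrow> real) \<phi>.
        iid_process N borel \<xi> \<and>
        \<phi> \<in> measurable (Pi\<^sub>M UNIV (\<lambda>_. borel)) (Pi\<^sub>M UNIV (\<lambda>_. E)) \<and>
        (\<forall>x k. \<phi> (\<lambda>i. x (i + k)) = (\<lambda>i. \<phi> x (i + k))) \<and>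
        distr N (Pi\<^sub>M UNIV (\<lambda>_. E)) (\<lambda>\<omega>. \<phi> (\<lambda>i. \<xi> i \<omega>)) =
          distr M (Pi\<^sub>M UNIV (\<lambda>_. E)) (\<lambda>\<omega> i. X i \<omega>))"

end

theory Submission
  imports Defs
begin

text \<open>
  Split the points of the process according to their minimum \<open>k\<close>, and let \<open>U\<^sub>k\<close> be the union of
  those with minimum \<open>k\<close>.  Points with different minima lie in disjoint regions, so the random
  subsets \<open>U\<^sub>k - k\<close> of \<open>\<nat>\<close> are independent: the events \<open>(U\<^sub>k - k) \<inter> N = \<emptyset>\<close> for finite \<open>N\<close> are
  void events of the Poisson process and form a generating \<open>\<pi>\<close>-system.  By translation invariance
  their probabilities do not depend on \<open>k\<close>.  Hence the \<open>U\<^sub>k - k\<close> are i.i.d., and up to a null set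
  \<open>X\<^sub>i = 1\<close> iff \<open>i - k \<in> U\<^sub>k - k\<close> for some \<open>k\<close>, which is a shift-equivariant function of them.
\<close>

section \<open>Coding bit sequences as reals\<close>

text \<open>\<open>factor_of_iid\<close> asks for a real-valued i.i.d. process, so a whole bit
  sequence is packed into one real. Base 4 with digits 0 and 1 avoids the ambiguity of binary
  expansions: the digits after the first add up to at most 1/3.\<close>

definition bits_real :: "(nat \<Rightarrow> bool) \<Rightarrow> real" where
  "bits_real b = (\<Sum>n. of_bool (b n) * (1/4) ^ n)"

lemma summable_bits_real: "summable (\<lambda>n. of_bool (b n) * (1/4::real) ^ n)"
  by (rule summable_comparison_test'[OF summable_geometric[of "1/4::real"], where N = 0]) auto

lemma bits_real_bounds: "0 \<le> bits_real b" "bits_real b \<le> 4/3"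
proof -
  show "0 \<le> bits_real b"
    unfolding bits_real_def by (intro suminf_nonneg summable_bits_real) auto
  have "bits_real b \<le> (\<Sum>n. (1/4::real) ^ n)"
    unfolding bits_real_def by (intro suminf_le summable_bits_real summable_geometric) auto
  also have "\<dots> = 4/3"
    by (subst suminf_geometric) auto
  finally show "bits_real b \<le> 4/3" .
qed

lemma bits_real_Suc: "bits_real b = of_bool (b 0) + bits_real (\<lambda>n. b (Suc n)) / 4"
  unfolding bits_real_def
  by (subst suminf_split_head[OF summable_bits_real[of b], symmetric, unfolded diff_eq_eq])
    (simp add: suminf_divide[OF summable_bits_real, symmetric])

text \<open>Multiplying by \<open>4 ^ n\<close> brings digit \<open>n\<close> to the units place.
  Earlier digits become multiples of 4, which do not affect parity, and later ones contribute less
  than 1. The decoder is thus an explicit Borel function of a real.\<close>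

lemma odd_floor_bits_real: "odd \<lfloor>4 ^ n * bits_real b\<rfloor> \<longleftrightarrow> b n"
proof (induction n arbitrary: b)
  case 0
  have "\<lfloor>bits_real b\<rfloor> = of_bool (b 0)"
    using bits_real_bounds[of "\<lambda>n. b (Suc n)"] bits_real_Suc[of b]
    by (intro floor_unique) auto
  then show ?case
    by simp
next
  case (Suc n)
  have "4 ^ Suc n * bits_real b =
      4 ^ n * bits_real (\<lambda>n. b (Suc n)) + of_int (4 ^ Suc n * of_bool (b 0))"
    by (subst bits_real_Suc) (simp add: algebra_simps)
  then have "\<lfloor>4 ^ Suc n * bits_real b\<rfloor> =
      \<lfloor>4 ^ n * bits_real (\<lambda>n. b (Suc n))\<rfloor> + 4 ^ Suc n * of_bool (b 0)"
    by (metis floor_add_int)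
  then show ?case
    using Suc.IH[of "\<lambda>n. b (Suc n)"] by simp
qed

text \<open>A pi-system adapted to Poisson processes: its preimages under \<open>min_bits\<close>
  are void events. It generates the product sigma-algebra, as the complements for singleton
  \<open>N\<close> are the coordinate events.\<close>

definition void_sets :: "(nat \<Rightarrow> bool) set set" where
  "void_sets = {{b. \<forall>n\<in>N. \<not> b n} | N. finite N}"

definition bit_space :: "(nat \<Rightarrow> bool) measure" where
  "bit_space = sigma UNIV void_sets"

lemma space_bit_space [simp]: "space bit_space = UNIV"
  by (simp add: bit_space_def)

lemma sets_bit_space: "sets bit_space = sigma_sets UNIV void_sets"
  by (simp add: bit_space_def)

lemma Int_stable_void_sets: "Int_stable void_sets"
proof (rule Int_stableI)
  fix a b assume "a \<in> void_sets" "b \<in> void_sets"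
  then obtain N N' where "finite N" "a = {b. \<forall>n\<in>N. \<not> b n}"
      "finite N'" "b = {b. \<forall>n\<in>N'. \<not> b n}"
    by (auto simp: void_sets_def)
  then have "finite (N \<union> N')" "a \<inter> b = {b. \<forall>n\<in>N \<union> N'. \<not> b n}"
    by auto
  then show "a \<inter> b \<in> void_sets"
    unfolding void_sets_def by blast
qed

lemma measurable_bits_real [measurable]: "bits_real \<in> borel_measurable bit_space"
proof -
  have "Measurable.pred bit_space (\<lambda>b. b n)" for n
  proof -
    have "{b. \<forall>m\<in>{n}. \<not> b m} \<in> sets bit_space"
      unfolding sets_bit_space void_sets_def by (intro sigma_sets.Basic) blast
    then have "UNIV - {b. \<forall>m\<in>{n}. \<not> b m} \<in> sets bit_space"
      by (metis sets.compl_sets space_bit_space)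
    moreover have "UNIV - {b. \<forall>m\<in>{n}. \<not> b m} = {b. b n}"
      by auto
    ultimately show ?thesis
      by (simp add: pred_def)
  qed
  note [measurable] = this
  show ?thesis
    unfolding bits_real_def[abs_def] of_bool_def by measurable
qed

section \<open>Measurable sets of sets of integers\<close>

lemma space_pow_int [simp]: "space pow_int = UNIV"
  by (simp add: pow_int_def)

lemma sets_pow_int_mem: "{S. i \<in> S} \<in> sets pow_int"
proof -
  have "(\<lambda>f. f i) \<in> borel_measurable (borel :: (int \<Rightarrow> bool) measure)"
    by (intro borel_measurable_continuous_onI) simp
  then have "(\<lambda>f. f i) -` {True} \<inter> space borel \<in> sets (borel :: (int \<Rightarrow> bool) measure)"
    by (rule measurable_sets) simp
  from in_vimage_algebra[OF this, of "\<lambda>S i. i \<in> S" UNIV] show ?thesis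
    by (simp add: pow_int_def vimage_def)
qed

text \<open>On indicator functions, translation by \<open>k\<close> is the reindexing
  \<open>i \<mapsto> i - k\<close>, which is continuous in the product topology.\<close>

lemma measurable_translate_pow_int: "(\<lambda>S. (\<lambda>i. i + k) ` S) \<in> measurable pow_int pow_int"
proof -
  have "(\<lambda>f i. f (i - k)) \<in> borel_measurable (borel :: (int \<Rightarrow> bool) measure)"
    by (intro borel_measurable_continuous_onI continuous_on_coordinatewise_then_product) simp
  then have "(\<lambda>S i. i - k \<in> S) \<in> measurable pow_int (borel :: (int \<Rightarrow> bool) measure)"
    using measurable_compose[OF measurable_vimage_algebra1[of "\<lambda>S i. i \<in> S" UNIV borel]]
    by (auto simp: pow_int_def)
  moreover have "i \<in> (\<lambda>i. i + k) ` S \<longleftrightarrow> i - k \<in> S" for i S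
    by (force simp: image_iff)
  ultimately show ?thesis
    unfolding pow_int_def by (intro measurable_vimage_algebra2) (simp_all add: pow_int_def[symmetric])
qed

lemma sets_pow_int_singleton_empty: "{{}} \<in> sets pow_int"
proof -
  have "UNIV - (\<Union>i. {S. i \<in> S}) \<in> sets pow_int"
    using sets.compl_sets[of "\<Union>i. {S. i \<in> S}" pow_int] sets_pow_int_mem by auto
  moreover have "UNIV - (\<Union>i::int. {S. i \<in> S}) = {{}}"
    by auto
  ultimately show ?thesis
    by simp
qed

lemma space_nonempty_pow_int [simp]: "space nonempty_pow_int = - {{}}"
  by (simp add: nonempty_pow_int_def space_restrict_space)

lemma sets_nonempty_pow_int_mem: "{S. i \<in> S} \<in> sets nonempty_pow_int"
proof -
  have "- {{}} \<in> sets pow_int"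
    using sets.compl_sets[OF sets_pow_int_singleton_empty] by (simp add: Compl_eq_Diff_UNIV)
  then show ?thesis
    unfolding nonempty_pow_int_def
    by (subst sets_restrict_space_iff) (auto simp: sets_pow_int_mem)
qed

lemma measurable_translate_nonempty_pow_int:
  "(\<lambda>S. (\<lambda>i. i + k) ` S) \<in> measurable nonempty_pow_int nonempty_pow_int"
  unfolding nonempty_pow_int_def
  by (intro measurable_restrict_space3 measurable_translate_pow_int) auto

text \<open>Stated through membership of single integers, so that measurability needs only countable
  Boolean operations on coordinate events.\<close>

definition has_min :: "int \<Rightarrow> int set set" where
  "has_min k = {S. k \<in> S \<and> (\<forall>i<k. i \<notin> S)}"

lemma has_min_unique: "S \<in> has_min k \<Longrightarrow> S \<in> has_min l \<Longrightarrow> k = l"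
  by (auto simp: has_min_def) (meson linorder_neqE)

lemma sets_has_min: "has_min k \<in> sets nonempty_pow_int"
proof -
  have "{S. k \<in> S} - (\<Union>i\<in>{..<k}. {S. i \<in> S}) \<in> sets nonempty_pow_int"
    by (intro sets.Diff sets.countable_UN'' sets_nonempty_pow_int_mem) auto
  moreover have "{S. k \<in> S} - (\<Union>i\<in>{..<k}. {S. i \<in> S}) = has_min k"
    by (auto simp: has_min_def)
  ultimately show ?thesis
    by simp
qed

text \<open>That no point of the process lies here means that the union of the points with minimum
  \<open>k\<close>, moved back by \<open>k\<close>, misses \<open>N\<close>.\<close>

definition hitting :: "int \<Rightarrow> nat set \<Rightarrow> int set set" where
  "hitting k N = has_min k \<inter> (\<Union>n\<in>N. {S. k + int n \<in> S})"

lemma sets_hitting: "hitting k N \<in> sets nonempty_pow_int"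
  unfolding hitting_def
  by (intro sets.Int sets_has_min sets.countable_UN'' sets_nonempty_pow_int_mem) auto

text \<open>Translation by \<open>k\<close> carries minimum 0 to minimum \<open>k\<close> and keeps
  the offsets from the minimum.\<close>

lemma translate_hitting:
  "(\<lambda>S. (\<lambda>i. i + k) ` S) -` hitting k N = hitting 0 N"
proof -
  have *: "i \<in> (\<lambda>i. i + k) ` S \<longleftrightarrow> i - k \<in> S" for i S
    by (force simp: image_iff)
  have "(\<forall>i<k. i - k \<notin> S) \<longleftrightarrow> (\<forall>i<0. i \<notin> S)" for S
    by (metis add_diff_cancel_right' diff_add_cancel diff_less_0_iff_less)
  then show ?thesis
    by (auto simp: hitting_def has_min_def *)
qed

lemma emeasure_hitting_translation_invariant:
  assumes "sets \<nu> = sets nonempty_pow_int" and "translation_invariant \<nu>"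
  shows "emeasure \<nu> (hitting k N) = emeasure \<nu> (hitting 0 N)"
proof -
  have m: "(\<lambda>S. (\<lambda>i. i + k) ` S) \<in> measurable \<nu> \<nu>"
    using measurable_translate_nonempty_pow_int by (simp cong: measurable_cong_sets add: assms(1))
  have sp: "hitting 0 N \<subseteq> space \<nu>"
    using sets.sets_into_space[OF sets_hitting, of 0 N] sets_eq_imp_space_eq[OF assms(1)] by simp
  have "emeasure \<nu> (hitting k N) =
      emeasure (distr \<nu> \<nu> (\<lambda>S. (\<lambda>i. i + k) ` S)) (hitting k N)"
    using assms(2) by (simp add: translation_invariant_def)
  also have "\<dots> = emeasure \<nu> (hitting 0 N)"
    using sp by (simp add: emeasure_distr[OF m] sets_hitting assms(1) translate_hitting Int_absorb2)
  finally show ?thesis .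
qed

section \<open>Void events of a Poisson process\<close>

lemma point_count_eq_0_iff: "point_count I B A \<omega> = 0 \<longleftrightarrow> (\<forall>j\<in>I \<omega>. B \<omega> j \<notin> A)"
  by (auto simp: point_count_def emeasure_count_space_eq_0)

text \<open>For finite intensity this is the Poisson formula at \<open>k = 0\<close>. Infinite
  intensity is a separate case because \<open>enn2real\<close> sends infinity to 0, which would give
  probability 1. The value depends on \<open>A\<close> only through its intensity.\<close>

lemma prob_void_event:
  assumes "poisson_process M \<nu> I B" and "A \<in> sets \<nu>"
  shows "measure M {\<omega> \<in> space M. point_count I B A \<omega> = 0} =
    (if emeasure \<nu> A = \<infinity> then 0 else exp (- enn2real (emeasure \<nu> A)))"
proof (cases "emeasure \<nu> A = \<infinity>")
  case True
  then have "AE \<omega> in M. point_count I B A \<omega> = \<infinity>"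
    using assms by (auto simp: poisson_process_def)
  then have "AE \<omega> in M. \<omega> \<notin> {\<omega> \<in> space M. point_count I B A \<omega> = 0}"
    by eventually_elim auto
  then have "emeasure M {\<omega> \<in> space M. point_count I B A \<omega> = 0} = 0"
    by (simp add: emeasure_eq_0_AE)
  then show ?thesis
    using True by (simp add: measure_def)
next
  case False
  then have "measure M {\<omega> \<in> space M. point_count I B A \<omega> = of_nat 0} =
      measure \<nu> A ^ 0 / fact 0 * exp (- measure \<nu> A)"
    using assms unfolding poisson_process_def top.not_eq_extremum infinity_ennreal_def by blast
  then show ?thesis
    using False by (simp add: measure_def)
qed

lemma AE_no_points_in_null_set:
  assumes "poisson_process M \<nu> I B" and "A \<in> null_sets \<nu>"
  shows "AE \<omega> in M. \<forall>j\<in>I \<omega>. B \<omega> j \<notin> A"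
proof -
  interpret prob_space M
    using assms by (simp add: poisson_process_def)
  have "measure M {\<omega> \<in> space M. point_count I B A \<omega> = 0} = 1"
    using assms by (subst prob_void_event[OF assms(1)]) auto
  moreover have "point_count I B A \<in> borel_measurable M"
    using assms by (auto simp: poisson_process_def)
  then have "{\<omega> \<in> space M. point_count I B A \<omega> = 0} \<in> events"
    by measurable
  ultimately have "AE \<omega> in M. point_count I B A \<omega> = 0"
    by (simp add: prob_Collect_eq_1)
  then show ?thesis
    by eventually_elim (simp add: point_count_eq_0_iff)
qed

text \<open>\<open>poisson_process\<close> states independence of counts for families indexed by
  \<open>{..<n}\<close>. A bijection \<open>h\<close> from \<open>{..<card J}\<close> onto
  \<open>J\<close> carries it over, each void event being the preimage of \<open>{0}\<close> under a
  count.\<close>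

lemma prob_void_events_disjoint:
  assumes P: "poisson_process M \<nu> I B" and J: "finite J" "J \<noteq> {}"
    and A: "\<And>j. j \<in> J \<Longrightarrow> A j \<in> sets \<nu>" and disj: "disjoint_family_on A J"
  shows "measure M (\<Inter>j\<in>J. {\<omega> \<in> space M. point_count I B (A j) \<omega> = 0}) =
    (\<Prod>j\<in>J. measure M {\<omega> \<in> space M. point_count I B (A j) \<omega> = 0})"
proof -
  interpret prob_space M
    using P by (simp add: poisson_process_def)
  define V where "V a = {\<omega> \<in> space M. point_count I B a \<omega> = 0}" for a
  obtain h where h: "bij_betw h {..<card J} J"
    using J(1) ex_bij_betw_nat_finite[of J] by (auto simp: atLeast0LessThan)
  have "(A \<circ> h) ` {..<card J} \<subseteq> sets \<nu>"
    using h A by (auto simp: bij_betw_def)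
  moreover have "disjoint_family_on (A \<circ> h) {..<card J}"
    using h disj unfolding disjoint_family_on_def bij_betw_def inj_on_def
    by (simp add: image_iff) blast
  ultimately have "indep_vars (\<lambda>_. borel) (\<lambda>m. point_count I B ((A \<circ> h) m)) {..<card J}"
    using P unfolding poisson_process_def by blast
  then have "prob (\<Inter>m\<in>{..<card J}. point_count I B ((A \<circ> h) m) -` {0} \<inter> space M) =
      (\<Prod>m\<in>{..<card J}. prob (point_count I B ((A \<circ> h) m) -` {0} \<inter> space M))"
    using J by (intro indep_varsD) (auto simp: card_gt_0_iff lessThan_empty_iff)
  moreover have "point_count I B a -` {0} \<inter> space M = V a" for a
    by (auto simp: V_def)
  ultimately have "prob (\<Inter>m\<in>{..<card J}. V (A (h m))) = (\<Prod>m\<in>{..<card J}. prob (V (A (h m))))"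
    by simp
  moreover have "(\<Inter>m\<in>{..<card J}. V (A (h m))) = (\<Inter>j\<in>h ` {..<card J}. V (A j))"
    by simp
  moreover have "h ` {..<card J} = J"
    using h by (rule bij_betw_imp_surj_on)
  ultimately show ?thesis
    using prod.reindex_bij_betw[OF h, of "\<lambda>j. prob (V (A j))"] unfolding V_def by metis
qed

section \<open>The unions of the points with given minimum\<close>

text \<open>The indicator sequence of the union of the points with minimum \<open>k\<close>, moved
  back by \<open>k\<close>. Natural indices suffice since that union contains nothing below
  \<open>k\<close>.\<close>

definition min_bits :: "('w \<Rightarrow> 'j set) \<Rightarrow> ('w \<Rightarrow> 'j \<Rightarrow> int set) \<Rightarrow> int \<Rightarrow> 'w \<Rightarrow> nat \<Rightarrow> bool" where
  "min_bits I B k \<omega> n \<longleftrightarrow> (\<exists>j\<in>I \<omega>. B \<omega> j \<in> has_min k \<and> k + int n \<in> B \<omega> j)"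

lemma min_bits_void_iff:
  "(\<forall>n\<in>N. \<not> min_bits I B k \<omega> n) \<longleftrightarrow> point_count I B (hitting k N) \<omega> = 0"
  by (auto simp: min_bits_def point_count_eq_0_iff hitting_def)

lemma min_bits_vimage_void:
  "min_bits I B k -` {b. \<forall>n\<in>N. \<not> b n} \<inter> space M =
    {\<omega> \<in> space M. point_count I B (hitting k N) \<omega> = 0}"
  by (auto simp: min_bits_void_iff[symmetric])

context
  fixes \<nu> :: "int set measure" and M :: "'w measure"
    and I :: "'w \<Rightarrow> 'j set" and B :: "'w \<Rightarrow> 'j \<Rightarrow> int set"
  assumes sets_\<nu>: "sets \<nu> = sets nonempty_pow_int"
    and poisson: "poisson_process M \<nu> I B"
begin

interpretation prob_space M
  using poisson by (simp add: poisson_process_def)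

lemma measurable_point_count: "A \<in> sets nonempty_pow_int \<Longrightarrow> point_count I B A \<in> borel_measurable M"
  using poisson sets_\<nu> by (simp add: poisson_process_def)

lemma void_event_in_events:
  "A \<in> sets nonempty_pow_int \<Longrightarrow> {\<omega> \<in> space M. point_count I B A \<omega> = 0} \<in> events"
  using measurable_point_count[of A] by measurable

lemma measurable_min_bits: "min_bits I B k \<in> measurable M bit_space"
  unfolding bit_space_def
proof (rule measurable_measure_of)
  fix A assume "A \<in> void_sets"
  then obtain N where A: "A = {b. \<forall>n\<in>N. \<not> b n}"
    by (auto simp: void_sets_def)
  show "min_bits I B k -` A \<inter> space M \<in> events"
    unfolding A min_bits_vimage_void by (intro void_event_in_events sets_hitting)
qed auto

lemma indep_vars_min_bits: "indep_vars (\<lambda>_. bit_space) (min_bits I B) UNIV"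
proof -
  \<comment> \<open>Generators of the sigma-algebra of \<open>min_bits I B k\<close>. Independence
    is checked on them and then extended, since they are closed under intersection.\<close>
  define F where "F k = {min_bits I B k -` A \<inter> space M | A. A \<in> void_sets}" for k
  have F: "\<exists>N. a = {\<omega> \<in> space M. point_count I B (hitting k N) \<omega> = 0}" if aF: "a \<in> F k" for a k
  proof -
    obtain A where a: "a = min_bits I B k -` A \<inter> space M" "A \<in> void_sets"
      using aF by (auto simp: F_def)
    then obtain N where A: "A = {b. \<forall>n\<in>N. \<not> b n}"
      by (auto simp: void_sets_def)
    show ?thesis
      unfolding a A min_bits_vimage_void by blast
  qed
  have "indep_sets F UNIV"
  proof (rule indep_setsI)
    show "F k \<subseteq> events" for k
      using F void_event_in_events sets_hitting by blast
  next
    fix A and J :: "int set"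
    assume J: "J \<noteq> {}" "finite J" and "\<forall>k\<in>J. A k \<in> F k"
    then have "\<forall>k\<in>J. \<exists>N. A k = {\<omega> \<in> space M. point_count I B (hitting k N) \<omega> = 0}"
      using F by blast
    then obtain N where "\<forall>k\<in>J. A k = {\<omega> \<in> space M. point_count I B (hitting k (N k)) \<omega> = 0}"
      by metis
    \<comment> \<open>A set has at most one minimum, whatever the choice of the
      \<open>N k\<close>.\<close>
    moreover have "disjoint_family_on (\<lambda>k. hitting k (N k)) J"
      using has_min_unique by (fastforce simp: disjoint_family_on_def hitting_def)
    ultimately show "prob (\<Inter>k\<in>J. A k) = (\<Prod>k\<in>J. prob (A k))"
      using prob_void_events_disjoint[OF poisson J(2,1), of "\<lambda>k. hitting k (N k)"]
      by (simp add: sets_\<nu> sets_hitting)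
  qed
  moreover have "Int_stable (F k)" for k
  proof (rule Int_stableI)
    fix a b assume "a \<in> F k" "b \<in> F k"
    then obtain A A' where "A \<in> void_sets" "a = min_bits I B k -` A \<inter> space M"
        "A' \<in> void_sets" "b = min_bits I B k -` A' \<inter> space M"
      by (auto simp: F_def)
    then have "A \<inter> A' \<in> void_sets" "a \<inter> b = min_bits I B k -` (A \<inter> A') \<inter> space M"
      using Int_stable_void_sets by (auto dest: Int_stableD)
    then show "a \<inter> b \<in> F k"
      unfolding F_def by blast
  qed
  ultimately have "indep_sets (\<lambda>k. sigma_sets (space M) (F k)) UNIV"
    by (rule indep_sets_sigma)
  moreover have "{min_bits I B k -` A \<inter> space M | A. A \<in> sets bit_space} = sigma_sets (space M) (F k)" for k
    unfolding sets_bit_space F_def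
    by (rule sigma_sets_vimage_commute) auto
  ultimately show ?thesis
    using measurable_min_bits by (simp add: indep_vars_def2)
qed

text \<open>Two probability laws that agree on a generating pi-system coincide. On
  \<open>void_sets\<close> both are void probabilities, determined by the intensity of
  \<open>hitting\<close>, which translation invariance makes independent of
  \<open>k\<close>.\<close>

lemma distr_min_bits_eq:
  assumes "translation_invariant \<nu>"
  shows "distr M bit_space (min_bits I B k) = distr M bit_space (min_bits I B l)"
proof (rule measure_eqI_generator_eq[where E = void_sets and \<Omega> = UNIV and A = "\<lambda>_. UNIV"])
  fix X assume "X \<in> void_sets"
  then obtain N where X: "X = {b. \<forall>n\<in>N. \<not> b n}" "X \<in> sets bit_space"
    by (auto simp: void_sets_def sets_bit_space)
  have "emeasure \<nu> (hitting k N) = emeasure \<nu> (hitting l N)"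
    using emeasure_hitting_translation_invariant[OF sets_\<nu> assms] by metis
  then have "prob {\<omega> \<in> space M. point_count I B (hitting k N) \<omega> = 0} =
      prob {\<omega> \<in> space M. point_count I B (hitting l N) \<omega> = 0}"
    by (simp add: prob_void_event[OF poisson] sets_\<nu> sets_hitting)
  then show "emeasure (distr M bit_space (min_bits I B k)) X =
      emeasure (distr M bit_space (min_bits I B l)) X"
    unfolding emeasure_distr[OF measurable_min_bits X(2)]
    unfolding X(1) min_bits_vimage_void emeasure_eq_measure by simp
next
  \<comment> \<open>The whole space is the void set for \<open>N = {}\<close>.\<close>
  show "range (\<lambda>_::nat. UNIV) \<subseteq> void_sets"
    by (auto simp: void_sets_def intro!: exI[of _ "{}"])
  interpret D: prob_space "distr M bit_space (min_bits I B k)"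
    by (rule prob_space_distr[OF measurable_min_bits])
  show "emeasure (distr M bit_space (min_bits I B k)) UNIV \<noteq> \<infinity>" for i :: nat
    using D.emeasure_finite by simp
qed (auto simp: Int_stable_void_sets sets_bit_space)

text \<open>Site \<open>i\<close> is uncovered exactly on the void event of
  \<open>{S. i \<in> S}\<close>.\<close>

lemma measurable_covered_process:
  "covered_process I B i \<in> measurable M (count_space {0, 1})"
proof -
  have "{\<omega> \<in> space M. \<not> point_count I B {S. i \<in> S} \<omega> = 0} \<in> events"
    using void_event_in_events[OF sets_nonempty_pow_int_mem[of i]] by measurable
  then have "Measurable.pred M (\<lambda>\<omega>. i \<in> (\<Union>j\<in>I \<omega>. B \<omega> j))"
    by (simp add: pred_def point_count_eq_0_iff)
  then show ?thesis
    unfolding covered_process_def by measurable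
qed

lemma AE_covered_iff_min_bits:
  assumes "AE S in \<nu>. \<exists>m\<in>S. \<forall>s\<in>S. m \<le> s"
  shows "AE \<omega> in M. \<forall>i. covered_process I B i \<omega> =
    (if \<exists>n. min_bits I B (i - int n) \<omega> n then 1 else 0)"
proof -
  have min: "(\<exists>m\<in>S. \<forall>s\<in>S. m \<le> s) \<longleftrightarrow> S \<in> (\<Union>k. has_min k)" for S :: "int set"
    by (force simp: has_min_def not_less[symmetric])
  \<comment> \<open>The sets without a minimum form a null set of the intensity, so almost surely no
    point of the process is of this kind. Such a point would cover sites without showing up in any
    \<open>min_bits\<close>.\<close>
  have "space \<nu> - (\<Union>k. has_min k) \<in> sets \<nu>"
    by (intro sets.compl_sets sets.countable_UN'') (auto simp: sets_\<nu> sets_has_min)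
  moreover have "AE S in \<nu>. S \<notin> space \<nu> - (\<Union>k. has_min k)"
    using assms unfolding min by eventually_elim auto
  ultimately have "space \<nu> - (\<Union>k. has_min k) \<in> null_sets \<nu>"
    by (simp add: AE_iff_null_sets)
  then have "AE \<omega> in M. \<forall>j\<in>I \<omega>. B \<omega> j \<notin> space \<nu> - (\<Union>k. has_min k)"
    by (rule AE_no_points_in_null_set[OF poisson])
  then show ?thesis
    using AE_space
  proof eventually_elim
    case (elim \<omega>)
    have ex: "\<exists>k. B \<omega> j \<in> has_min k" if "j \<in> I \<omega>" for j
      using elim that poisson by (auto simp: poisson_process_def)
    have "(\<exists>n. min_bits I B (i - int n) \<omega> n) \<longleftrightarrow> i \<in> (\<Union>j\<in>I \<omega>. B \<omega> j)" for i
    proof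
      assume "i \<in> (\<Union>j\<in>I \<omega>. B \<omega> j)"
      then obtain j where j: "j \<in> I \<omega>" "i \<in> B \<omega> j"
        by auto
      then obtain k where k: "B \<omega> j \<in> has_min k"
        using ex by auto
      with j have "k \<le> i"
        by (force simp: has_min_def not_less[symmetric])
      \<comment> \<open>The offset of \<open>i\<close> from the minimum \<open>k\<close> of a point
        covering it; \<open>k \<le> i\<close> makes it a natural number.\<close>
      then have "min_bits I B (i - int (nat (i - k))) \<omega> (nat (i - k))"
        using j k by (auto simp: min_bits_def)
      then show "\<exists>n. min_bits I B (i - int n) \<omega> n" ..
    qed (auto simp: min_bits_def)
    then show ?case
      by (simp add: covered_process_def)
  qed
qed

end

section \<open>The factor map\<close>

text \<open>Passage to the canonical model: \<open>factor_of_iid\<close> fixes the sample space to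
  integer-indexed real sequences, so the process is replaced by the coordinates under its joint
  law.\<close>

lemma (in prob_space) iid_process_coordinates:
  fixes X :: "int \<Rightarrow> 'a \<Rightarrow> 'e"
  assumes indep: "indep_vars (\<lambda>_. E) X UNIV"
    and ident: "\<And>i j. distr M E (X i) = distr M E (X j)"
  shows "iid_process (distr M (\<Pi>\<^sub>M i\<in>UNIV. E) (\<lambda>\<omega> i. X i \<omega>)) E (\<lambda>i x. x i)"
proof -
  let ?N = "distr M (\<Pi>\<^sub>M i\<in>UNIV. E) (\<lambda>\<omega> i. X i \<omega>)"
  have X: "X i \<in> measurable M E" for i
    using indep by (simp add: indep_vars_def2)
  have XP: "(\<lambda>\<omega> i. X i \<omega>) \<in> measurable M (\<Pi>\<^sub>M i\<in>UNIV. E)"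
    using X by (intro measurable_PiM_single') (auto dest: measurable_space)
  interpret N: prob_space ?N
    by (rule prob_space_distr[OF XP])
  have coord: "distr ?N E (\<lambda>x. x i) = distr M E (X i)" for i
    by (subst distr_distr[OF _ XP]) (auto simp: comp_def)
  \<comment> \<open>The joint law of the coordinates is \<open>?N\<close> itself. Independence of
    \<open>X\<close> identifies \<open>?N\<close> with the product of its marginals, and the same
    criterion then yields independence of the coordinates.\<close>
  have "distr ?N (\<Pi>\<^sub>M i\<in>UNIV. E) (\<lambda>x. \<lambda>i\<in>UNIV. x i) = ?N"
    by (simp add: restrict_UNIV distr_id2)
  also have "?N = (\<Pi>\<^sub>M i\<in>UNIV. distr ?N E (\<lambda>x. x i))"
    using indep X indep_vars_iff_distr_eq_PiM[of UNIV X "\<lambda>_. E"]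
    unfolding coord by (simp add: restrict_UNIV)
  finally have "N.indep_vars (\<lambda>_. E) (\<lambda>i x. x i) UNIV"
    by (subst N.indep_vars_iff_distr_eq_PiM) auto
  then show ?thesis
    using ident N.prob_space_axioms by (simp add: iid_process_def coord)
qed

text \<open>Decodes digit \<open>n\<close> of the real at site \<open>i - n\<close>. It is defined
  on all real sequences, so it commutes with shifts everywhere and not just almost surely.\<close>

definition cover_factor :: "(int \<Rightarrow> real) \<Rightarrow> int \<Rightarrow> nat" where
  "cover_factor x i = (if \<exists>n. odd \<lfloor>4 ^ n * x (i - int n)\<rfloor> then 1 else 0)"

lemma cover_factor_shift: "cover_factor (\<lambda>i. x (i + k)) = (\<lambda>i. cover_factor x (i + k))"
  by (simp add: cover_factor_def fun_eq_iff algebra_simps)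

lemma measurable_cover_factor:
  "cover_factor \<in> measurable (\<Pi>\<^sub>M i\<in>UNIV. borel) (\<Pi>\<^sub>M i\<in>UNIV. count_space {0, 1})"
proof -
  have "(\<lambda>x. cover_factor x i) \<in> measurable (\<Pi>\<^sub>M i\<in>UNIV. borel) (count_space {0, 1})" for i
    unfolding cover_factor_def by measurable
  then have "(\<lambda>x i. cover_factor x i) \<in> measurable (\<Pi>\<^sub>M i\<in>UNIV. borel) (\<Pi>\<^sub>M i\<in>UNIV. count_space {0, 1})"
    by (intro measurable_PiM_single') (auto simp: cover_factor_def split: if_splits)
  then show ?thesis
    by simp
qed

theorem theorem7p5:
  fixes \<nu> :: "int set measure"
    and M :: "'w measure"
    and I :: "'w \<Rightarrow> 'j set"
    and B :: "'w \<Rightarrow> 'j \<Rightarrow> int set"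
  assumes "sets \<nu> = sets nonempty_pow_int"
    and "sigma_finite_measure \<nu>"
    and "translation_invariant \<nu>"
    and "AE S in \<nu>. \<exists>m\<in>S. \<forall>s\<in>S. m \<le> s"
    and "poisson_process M \<nu> I B"
  shows "factor_of_iid M (count_space {0, 1}) (covered_process I B)"
proof -
  interpret prob_space M
    using assms(5) by (simp add: poisson_process_def)
  let ?E = "\<Pi>\<^sub>M i\<in>UNIV. count_space {0, 1 :: nat}"
  let ?R = "\<Pi>\<^sub>M i\<in>UNIV. (borel :: real measure)"
  define X where "X k \<omega> = bits_real (min_bits I B k \<omega>)" for k \<omega>
  define N where "N = distr M ?R (\<lambda>\<omega> k. X k \<omega>)"
  note min_bits = measurable_min_bits[OF assms(1,5)]
  have X: "X k \<in> borel_measurable M" for k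
    unfolding X_def by (rule measurable_compose[OF min_bits measurable_bits_real])
  have XP: "(\<lambda>\<omega> k. X k \<omega>) \<in> measurable M ?R"
    using X by (intro measurable_PiM_single') auto
  have "indep_vars (\<lambda>_. borel) X UNIV"
    unfolding X_def[abs_def]
    by (rule indep_vars_compose2[OF indep_vars_min_bits[OF assms(1,5)]]) (rule measurable_bits_real)
  moreover have "distr M borel (X k) = distr M borel (X l)" for k l
  proof -
    have "distr M borel (X k) = distr (distr M bit_space (min_bits I B k)) borel bits_real" for k
      by (subst distr_distr[OF measurable_bits_real min_bits]) (simp add: X_def[abs_def] comp_def)
    then show ?thesis
      using distr_min_bits_eq[OF assms(1,5,3)] by metis
  qed
  ultimately have "iid_process N borel (\<lambda>i x. x i)"
    unfolding N_def by (rule iid_process_coordinates)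
  \<comment> \<open>The decoded process and \<open>covered_process\<close> agree only almost surely,
    which suffices for equality of laws.\<close>
  moreover have "distr N ?E cover_factor = distr M ?E (\<lambda>\<omega> i. covered_process I B i \<omega>)"
    unfolding N_def distr_distr[OF measurable_cover_factor XP]
  proof (rule distr_cong_AE)
    show "AE \<omega> in M. (cover_factor \<circ> (\<lambda>\<omega> k. X k \<omega>)) \<omega> = (\<lambda>i. covered_process I B i \<omega>)"
      using AE_covered_iff_min_bits[OF assms(1,5,4)]
      by eventually_elim (simp add: fun_eq_iff cover_factor_def X_def odd_floor_bits_real)
    show "cover_factor \<circ> (\<lambda>\<omega> k. X k \<omega>) \<in> measurable M ?E"
      by (rule measurable_comp[OF XP measurable_cover_factor])
    show "(\<lambda>\<omega> i. covered_process I B i \<omega>) \<in> measurable M ?E"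
      by (intro measurable_PiM_single' measurable_covered_process[OF assms(1,5)])
        (auto simp: covered_process_def split: if_splits)
  qed auto
  ultimately show ?thesis
    unfolding factor_of_iid_def
    using measurable_covered_process[OF assms(1,5)] measurable_cover_factor cover_factor_shift
    by (intro conjI allI exI[of _ N] exI[of _ "\<lambda>i x. x i"] exI[of _ cover_factor]) auto
qed

end
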